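(* Let $\gamma\in(1,2]$ and let $\mathcal F$ be the function associated with the $\gamma$-law equation of state and a conservative vector $\mathbf U=(D,\mathbf m^\top,\mathbf B^\top,E)^\top$ (see context). Then for any $\mathbf U\in\mathcal G$ and any $\xi\in\Omega_2$, $$\xi\,\mathcal F'''(\xi)+4\,\mathcal F''(\xi)>0.$$
   Context: Conservative vectors are $\mathbf U=(D,\mathbf m^\top,\mathbf B^\top,E)^\top$ with $D,E\in\mathbb R$ and $\mathbf m,\mathbf B\in\mathbb R^3$. Write $m=|\mathbf m|$, $B=|\mathbf B|$, $\tau=\mathbf m\cdot\mathbf B$. The admissible set $\mathcal G$ is the set of all $\mathbf U$ with $D>0$, $E-\sqrt{D^2+m^2}>0$ and $\Psi(\mathbf U)>0$, where $$\Phi(\mathbf U)=\sqrt{(B^2-E)^2+3(E^2-D^2-m^2)},$$ $$\Psi(\mathbf U)=\big(\Phi(\mathbf U)-2(B^2-E)\big)\sqrt{\Phi(\mathbf U)+B^2-E}-\sqrt{\tfrac{27}{2}(D^2B^2+\tau^2)}.$$ Define $$f_a(\xi)=\xi^2(\xi+B^2)^2-\big(\xi^2m^2+(2\xi+B^2)\tau^2\big),\qquad f_b(\xi)=f_a(\xi)-D^2(\xi+B^2)^2.$$ For $\mathbf U\in\mathcal G$ it is known that $f_a$ has at least one non-negative root. Let $\xi_a$ be its largest non-negative root; then $\Omega_1:=\{\xi>0:f_a(\xi)>0\}=(\xi_a,+\infty)$. It is known that $f_b$ has a unique root $\xi_b$ in $\Omega_1$ and that $f_b>0$ on $\Omega_2:=(\xi_b,+\infty)$.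 For $\xi\in\Omega_1$ let $$\mathcal W(\xi)=\frac{\xi(\xi+B^2)}{\sqrt{f_a(\xi)}},$$ $$\mathcal F(\xi)=\xi-\frac{\gamma-1}{\gamma}\Big(\frac{\xi}{\mathcal W(\xi)^2}-\frac{D}{\mathcal W(\xi)}\Big)-\frac12\Big(\frac{B^2}{\mathcal W(\xi)^2}+\frac{\tau^2}{\xi^2}\Big)+B^2-E.$$ (This is the function for the $\gamma$-law equation of state $h=1+\frac{\gamma p}{(\gamma-1)\rho}$.)
   Formalization: The formal theorem additionally assumes m ≠ 0; for m = 0 one has W = 1 on ξ > 0, so F is affine there and ξF''' + 4F'' = 0, and the strict inequality fails for every such U in G. *)

theory Defs
  imports "HOL-Analysis.Analysis"
begin

record conservative =
  cD :: real
  cm :: "real ^ 3"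
  cB :: "real ^ 3"
  cE :: real

definition tau :: "conservative \<Rightarrow> real" where
  "tau U = cm U \<bullet> cB U"

definition Phi :: "conservative \<Rightarrow> real" where
  "Phi U = sqrt (((norm (cB U))\<^sup>2 - cE U)\<^sup>2 + 3 * ((cE U)\<^sup>2 - (cD U)\<^sup>2 - (norm (cm U))\<^sup>2))"

definition Psi :: "conservative \<Rightarrow> real" where
  "Psi U = (Phi U - 2 * ((norm (cB U))\<^sup>2 - cE U)) * sqrt (Phi U + (norm (cB U))\<^sup>2 - cE U)
           - sqrt (27 / 2 * ((cD U)\<^sup>2 * (norm (cB U))\<^sup>2 + (tau U)\<^sup>2))"

text \<open>Isabelle's \<open>sqrt\<close> is odd on negative arguments. The first two conditions make the radicand
  of \<open>Phi\<close> and \<open>Phi + B\<^sup>2 - E\<close> in \<open>Psi\<close> positive, so membership only involves genuine square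
  roots.\<close>

definition admissible :: "conservative set" where
  "admissible = {U. cD U > 0 \<and> cE U - sqrt ((cD U)\<^sup>2 + (norm (cm U))\<^sup>2) > 0 \<and> Psi U > 0}"

definition f_a :: "conservative \<Rightarrow> real \<Rightarrow> real" where
  "f_a U \<xi> = \<xi>\<^sup>2 * (\<xi> + (norm (cB U))\<^sup>2)\<^sup>2
             - (\<xi>\<^sup>2 * (norm (cm U))\<^sup>2 + (2 * \<xi> + (norm (cB U))\<^sup>2) * (tau U)\<^sup>2)"

definition f_b :: "conservative \<Rightarrow> real \<Rightarrow> real" where
  "f_b U \<xi> = f_a U \<xi> - (cD U)\<^sup>2 * (\<xi> + (norm (cB U))\<^sup>2)\<^sup>2"

definition Omega1 :: "conservative \<Rightarrow> real set" where
  "Omega1 U = {\<xi>. \<xi> > 0 \<and> f_a U \<xi> > 0}"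

text \<open>For admissible \<open>U\<close> the root below exists and is unique. On \<open>\<xi> > 0\<close>, the quotient of
  \<open>f_b U \<xi>\<close> by \<open>\<xi>\<^sup>2 (\<xi> + B\<^sup>2)\<^sup>2\<close> increases strictly from \<open>-\<infinity>\<close> to \<open>1\<close>, and
  \<open>f_b U \<xi> = 0\<close> gives \<open>f_a U \<xi> > 0\<close> because \<open>D > 0\<close>.\<close>

definition xi_b :: "conservative \<Rightarrow> real" where
  "xi_b U = (THE \<xi>. \<xi> \<in> Omega1 U \<and> f_b U \<xi> = 0)"

definition Omega2 :: "conservative \<Rightarrow> real set" where
  "Omega2 U = {xi_b U <..}"

definition W :: "conservative \<Rightarrow> real \<Rightarrow> real" where
  "W U \<xi> = \<xi> * (\<xi> + (norm (cB U))\<^sup>2) / sqrt (f_a U \<xi>)"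

text \<open>\<open>W\<close> and \<open>F\<close> are meaningful on \<open>Omega1 U\<close> only. For admissible \<open>U\<close> this is an open set
  containing \<open>Omega2 U\<close>, so the values outside do not affect derivatives at points of \<open>Omega2 U\<close>.\<close>

definition F :: "real \<Rightarrow> conservative \<Rightarrow> real \<Rightarrow> real" where
  "F \<gamma> U \<xi> = \<xi> - (\<gamma> - 1) / \<gamma> * (\<xi> / (W U \<xi>)\<^sup>2 - cD U / W U \<xi>)
               - 1 / 2 * ((norm (cB U))\<^sup>2 / (W U \<xi>)\<^sup>2 + (tau U)\<^sup>2 / \<xi>\<^sup>2)
               + (norm (cB U))\<^sup>2 - cE U"

text \<open>If \<open>cm U = 0\<close>, then \<open>tau U = 0\<close>, \<open>W U\<close> is constantly \<open>1\<close> on the positive reals and \<open>F \<gamma> U\<close> is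
  affine there, so all its derivatives of order at least two vanish. Strict inequalities between
  them therefore need \<open>cm U \<noteq> 0\<close>.\<close>

end

theory Submission
  imports Defs
begin

text \<open>Write \<open>b = B\<^sup>2\<close>, \<open>k = (\<gamma> - 1) / \<gamma>\<close> and choose \<open>A, C \<ge> 0\<close> with \<open>A + C = m\<^sup>2\<close>, \<open>C b = \<tau>\<^sup>2\<close>. Partial
  fractions give \<open>1 / W\<^sup>2 = 1 - u\<close> with \<open>u = A / (\<xi> + b)\<^sup>2 + C / \<xi>\<^sup>2\<close>, and up to an affine function
  \<open>F = k \<xi> u + k D sqrt (1 - u) + b A / (2 (\<xi> + b)\<^sup>2)\<close>. Hence \<open>\<xi> F''' + 4 F''\<close> is affine in \<open>D\<close>, and
  \<open>\<xi> > \<xi>\<^sub>b\<close> means \<open>0 < D < \<xi> sqrt (1 - u)\<close>. It remains to treat the two endpoints, which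
  in the variables \<open>c = C / \<xi>\<^sup>2\<close>, \<open>a = A / (\<xi> + b)\<^sup>2\<close> and \<open>t = \<xi> / (\<xi> + b)\<close> are polynomial inequalities;
  the first one uses \<open>k \<le> 1 / 2\<close> and the second one reduces to
  \<open>3 R\<^sup>2 + R (9 t - 4) + 12 t\<^sup>2 - 18 t + 8 \<ge> 0\<close> for \<open>R = (c + a t) / (1 - u)\<close>.\<close>

section \<open>Polynomial inequalities for the two endpoints in \<open>D\<close>\<close>

text \<open>As a quadratic in \<open>R\<close> this has no negative coefficient when
  \<open>t \<ge> 4/9\<close>, and a nonpositive discriminant when \<open>t < 4/9\<close>.\<close>

lemma quadratic_nonneg:
  fixes R t :: real
  assumes "0 \<le> R" "0 \<le> t"
  shows "0 \<le> 3 * R\<^sup>2 + R * (9 * t - 4) + (12 * t\<^sup>2 - 18 * t + 8)"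
proof (cases "4/9 \<le> t")
  case True
  have "12 * t\<^sup>2 - 18 * t + 8 = 12 * (t - 3/4)\<^sup>2 + 5/4"
    by (simp add: power2_eq_square algebra_simps)
  moreover have "0 \<le> R * (9 * t - 4)"
    using True assms by (intro mult_nonneg_nonneg) auto
  ultimately show ?thesis
    using zero_le_power2[of R] zero_le_power2[of "t - 3/4"] by linarith
next
  case False
  \<comment> \<open>The product is minus the discriminant; the square in \<open>R\<close> is
    completed afterwards.\<close>
  have "0 \<le> (4 - 3 * t) * (20 - 21 * t)"
    using False by (intro mult_nonneg_nonneg) auto
  hence "(9 * t - 4)\<^sup>2 \<le> 12 * (12 * t\<^sup>2 - 18 * t + 8)"
    using assms False by (simp add: power2_eq_square algebra_simps)
  hence "0 \<le> (6 * R + (9 * t - 4))\<^sup>2 + (12 * (12 * t\<^sup>2 - 18 * t + 8) - (9 * t - 4)\<^sup>2)"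
    by (intro add_nonneg_nonneg) auto
  also have "\<dots> = 12 * (3 * R\<^sup>2 + R * (9 * t - 4) + (12 * t\<^sup>2 - 18 * t + 8))"
    by (simp add: power2_eq_square algebra_simps)
  finally show ?thesis
    unfolding zero_le_mult_iff by simp
qed

text \<open>Here \<open>e\<close> stands for \<open>D\<close> divided by its upper bound and
  \<open>w\<close> for \<open>1 - u\<close>. The expression is affine in \<open>e\<close>, so the
  values at \<open>e = 0\<close> and \<open>e = 1\<close> decide.\<close>

lemma scaled_inequality:
  fixes a c t w e k :: real
  assumes "0 \<le> a" "0 \<le> c" "0 < a + c" "0 < t" "t \<le> 1" "0 < w" "0 < e" "e < 1"
    and "0 < k" "k \<le> 1/2"
  defines "P \<equiv> c + a * t" and "Q \<equiv> c + a * t\<^sup>2"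
  shows "0 < k * (- 16 * P + 42 * Q - 24 * (c + a * t ^ 3)) + 12 * (1 - t)\<^sup>2 * a * t
    + k * e * (12 * (c + a * t ^ 3) - 12 * Q + (9 * P * Q - 4 * P\<^sup>2) / w + 3 * P ^ 3 / w\<^sup>2)"
    (is "0 < k * ?L + _ + k * e * ?M")
proof -
  \<comment> \<open>The value at \<open>e = 0\<close> divided by \<open>k\<close>, taken at
    \<open>k = 1/2\<close>. For smaller \<open>k\<close> the nonnegative term without factor
    \<open>k\<close> weighs more, so \<open>k * X\<close> is a lower bound.\<close>
  define X where "X = 2 * c + a * t * (8 - 6 * t)"
  define R where "R = P / w"
  have at: "0 \<le> a * t" and P: "0 \<le> P" and R: "0 \<le> R"
    using assms by (auto simp: R_def P_def)
  have X: "0 < X"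
  proof (cases "a = 0")
    case False
    hence "0 < a * t * (8 - 6 * t)"
      using assms by (intro mult_pos_pos) auto
    thus ?thesis using assms by (simp add: X_def)
  qed (use assms in \<open>simp add: X_def\<close>)
  have M: "X + ?M = 2 * c + a * t * (12 * t\<^sup>2 - 18 * t + 8)
      + R * (5 * c + a * t * (9 * t - 4)) + 3 * (c + a * t) * R\<^sup>2"
    using \<open>0 < w\<close> by (simp add: X_def R_def P_def Q_def field_simps power2_eq_square power3_eq_cube)
  \<comment> \<open>Sorted by \<open>c\<close> and \<open>a * t\<close>: the \<open>c\<close> terms
    are nonnegative, and the cofactor of \<open>a * t\<close> is the quadratic of
    \<open>quadratic_nonneg\<close>.\<close>
  have "\<dots> = 2 * c + 5 * R * c + 3 * c * R\<^sup>2
      + a * t * (3 * R\<^sup>2 + R * (9 * t - 4) + (12 * t\<^sup>2 - 18 * t + 8))"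
    by (simp add: algebra_simps)
  also have "\<dots> \<ge> 0"
    using assms R mult_nonneg_nonneg[OF at quadratic_nonneg[of R t]]
    by (intro add_nonneg_nonneg) auto
  finally have XM: "0 \<le> X + ?M"
    using M by simp
  have "k * (24 * (1 - t)\<^sup>2 * a * t) \<le> 1/2 * (24 * (1 - t)\<^sup>2 * a * t)"
    using assms by (intro mult_right_mono) auto
  hence "k * (24 * (1 - t)\<^sup>2 * a * t) \<le> 12 * (1 - t)\<^sup>2 * a * t"
    by simp
  moreover have "?L + 24 * (1 - t)\<^sup>2 * a * t = X"
    by (simp add: X_def P_def Q_def algebra_simps power2_eq_square power3_eq_cube)
  hence "k * ?L + k * (24 * (1 - t)\<^sup>2 * a * t) = k * X"
    by (metis distrib_left)
  ultimately have "k * X \<le> k * ?L + 12 * (1 - t)\<^sup>2 * a * t"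
    by linarith
  \<comment> \<open>Convex combination of the endpoint values; \<open>e < 1\<close> and
    \<open>0 < X\<close> make it strict.\<close>
  moreover have "0 < k * ((1 - e) * X + e * (X + ?M))"
    using assms X XM by (intro mult_pos_pos add_pos_nonneg) auto
  hence "0 < k * X + k * e * ?M"
    by (simp add: algebra_simps)
  ultimately show ?thesis by linarith
qed

section \<open>Higher derivatives from local closed forms\<close>

text \<open>\<open>deriv\<close> at a point sees only nearby values, so agreement on an open set
  survives each differentiation; agreement at \<open>x\<close> alone would not.\<close>

lemma iterated_deriv_eq:
  fixes f g0 g1 g2 g3 :: "real \<Rightarrow> real"
  assumes "open S" "x \<in> S"
    and eq: "\<And>y. y \<in> S \<Longrightarrow> f y = g0 y"
    and d0: "\<And>y. y \<in> S \<Longrightarrow> (g0 has_real_derivative g1 y) (at y)"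
    and d1: "\<And>y. y \<in> S \<Longrightarrow> (g1 has_real_derivative g2 y) (at y)"
    and d2: "\<And>y. y \<in> S \<Longrightarrow> (g2 has_real_derivative g3 y) (at y)"
  shows "(deriv ^^ 2) f x = g2 x \<and> (deriv ^^ 3) f x = g3 x"
proof -
  have step: "deriv h y = h' y"
    if "\<And>y. y \<in> S \<Longrightarrow> h y = g y" "\<And>y. y \<in> S \<Longrightarrow> (g has_real_derivative h' y) (at y)" "y \<in> S"
    for h g h' :: "real \<Rightarrow> real" and y
    using that has_field_derivative_transform_within_open[OF that(2) \<open>open S\<close>, of y h]
    by (intro DERIV_imp_deriv) auto
  have 1: "deriv f y = g1 y" if "y \<in> S" for y
    using step[OF eq d0] that by blast
  have 2: "deriv (deriv f) y = g2 y" if "y \<in> S" for y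
    using step[OF 1 d1] that by blast
  have 3: "deriv (deriv (deriv f)) y = g3 y" if "y \<in> S" for y
    using step[OF 2 d2] that by blast
  show ?thesis
    using 2 3 \<open>x \<in> S\<close> by (simp_all add: numeral_2_eq_2 numeral_3_eq_3)
qed

lemma sqrt_one_minus_derivs:
  fixes u u1 u2 u3 :: "real \<Rightarrow> real"
  assumes "(u has_real_derivative u1 y) (at y)" "(u1 has_real_derivative u2 y) (at y)"
    "(u2 has_real_derivative u3 y) (at y)" and "u y < 1"
  defines "s \<equiv> \<lambda>y. sqrt (1 - u y)"
  shows "(s has_real_derivative - u1 y / (2 * s y)) (at y)"
    and "((\<lambda>y. - u1 y / (2 * s y)) has_real_derivative
           - u2 y / (2 * s y) - (u1 y)\<^sup>2 / (4 * s y ^ 3)) (at y)"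
    and "((\<lambda>y. - u2 y / (2 * s y) - (u1 y)\<^sup>2 / (4 * s y ^ 3)) has_real_derivative
           - u3 y / (2 * s y) - 3 * u1 y * u2 y / (4 * s y ^ 3) - 3 * u1 y ^ 3 / (8 * s y ^ 5)) (at y)"
proof -
  have s: "s y > 0" using assms by (simp add: s_def)
  show ds: "(s has_real_derivative - u1 y / (2 * s y)) (at y)"
    unfolding s_def using assms(1,4) by (auto intro!: derivative_eq_intros simp: field_simps)
  show "((\<lambda>y. - u1 y / (2 * s y)) has_real_derivative
           - u2 y / (2 * s y) - (u1 y)\<^sup>2 / (4 * s y ^ 3)) (at y)"
    using s by (auto intro!: derivative_eq_intros assms ds
        simp: field_simps power2_eq_square power3_eq_cube)
  show "((\<lambda>y. - u2 y / (2 * s y) - (u1 y)\<^sup>2 / (4 * s y ^ 3)) has_real_derivative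
           - u3 y / (2 * s y) - 3 * u1 y * u2 y / (4 * s y ^ 3) - 3 * u1 y ^ 3 / (8 * s y ^ 5)) (at y)"
    using s by (auto intro!: derivative_eq_intros assms ds
        simp: field_simps power2_eq_square power3_eq_cube eval_nat_numeral)
qed

section \<open>Partial fractions and the bound on \<open>D\<close> over
  \<open>Omega2\<close>\<close>

text \<open>\<open>C\<close> and \<open>A\<close> are the squared lengths of the parts of
  \<open>cm U\<close> along and orthogonal to \<open>cB U\<close>, whence Cauchy-Schwarz. If
  \<open>cB U = 0\<close>, the last equation is \<open>0 = 0\<close> and \<open>C = 0\<close> is
  chosen.\<close>

lemma partial_fraction_coefficients:
  obtains A C :: real where "0 \<le> A" "0 \<le> C" "A + C = (norm (cm U))\<^sup>2" "C * (norm (cB U))\<^sup>2 = (tau U)\<^sup>2"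
proof (cases "cB U = 0")
  case True
  thus ?thesis using that[of "(norm (cm U))\<^sup>2" 0] by (simp add: tau_def)
next
  case False
  have "(tau U)\<^sup>2 \<le> (norm (cm U))\<^sup>2 * (norm (cB U))\<^sup>2"
    using Cauchy_Schwarz_ineq[of "cm U" "cB U"] by (simp add: tau_def power2_norm_eq_inner)
  thus ?thesis
    using False that[of "(norm (cm U))\<^sup>2 - (tau U)\<^sup>2 / (norm (cB U))\<^sup>2" "(tau U)\<^sup>2 / (norm (cB U))\<^sup>2"]
    by (simp add: field_simps)
qed

text \<open>With \<open>W\<close> as Lorentz factor, \<open>1 - 1 / W\<^sup>2\<close> is the squared
  fluid speed. Free parameters let the same function describe \<open>f_b\<close>, with
  \<open>C\<close> enlarged by \<open>D\<^sup>2\<close>.\<close>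

definition speed_sq :: "real \<Rightarrow> real \<Rightarrow> real \<Rightarrow> real \<Rightarrow> real" where
  "speed_sq A C b y = A / (y + b)\<^sup>2 + C / y\<^sup>2"

lemma f_a_eq_speed_sq:
  assumes "A + C = (norm (cm U))\<^sup>2" "C * (norm (cB U))\<^sup>2 = (tau U)\<^sup>2" "0 < y"
  shows "f_a U y = (y * (y + (norm (cB U))\<^sup>2))\<^sup>2 * (1 - speed_sq A C ((norm (cB U))\<^sup>2) y)"
proof -
  define b where "b = (norm (cB U))\<^sup>2"
  define z where "z = y + b"
  have "0 < z" using assms by (simp add: z_def b_def add_pos_nonneg)
  hence "(y * z)\<^sup>2 * (1 - speed_sq A C b y) = (y * z)\<^sup>2 - (A * y\<^sup>2 + C * z\<^sup>2)"
    using \<open>0 < y\<close> unfolding speed_sq_def z_def[symmetric] by (simp add: field_simps)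
  hence "(y * (y + b))\<^sup>2 * (1 - speed_sq A C b y) = (y * (y + b))\<^sup>2 - (A * y\<^sup>2 + C * (y + b)\<^sup>2)"
    by (simp add: z_def)
  \<comment> \<open>The \<tau> term comes from
    \<open>C * (y + b)\<^sup>2 = C * y\<^sup>2 + (2 * y + b) * (C * b)\<close>.\<close>
  also have "\<dots> = y\<^sup>2 * (y + b)\<^sup>2 - (y\<^sup>2 * (A + C) + (2 * y + b) * (C * b))"
    by (simp add: algebra_simps power2_eq_square)
  finally show ?thesis
    using assms by (simp add: f_a_def b_def)
qed

lemma speed_sq_less:
  assumes "0 \<le> A" "0 < C" "0 \<le> b" "0 < x" "x < y"
  shows "speed_sq A C b y < speed_sq A C b x"
proof -
  have "C / y\<^sup>2 < C / x\<^sup>2"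
    using assms by (intro divide_strict_left_mono) (auto intro!: power_strict_mono)
  moreover have "A / (y + b)\<^sup>2 \<le> A / (x + b)\<^sup>2"
    using assms by (intro divide_left_mono) (auto intro!: power_mono)
  ultimately show ?thesis
    by (simp add: speed_sq_def)
qed

text \<open>Intermediate values between \<open>sqrt C\<close>, where the second summand alone is 1,
  and \<open>sqrt (A + C)\<close>, where dropping \<open>b\<close> from the denominator bounds the
  sum by 1. Strict decrease gives uniqueness.\<close>

lemma speed_sq_eq_1_ex1:
  assumes "0 \<le> A" "0 < C" "0 \<le> b"
  shows "\<exists>!x. 0 < x \<and> speed_sq A C b x = 1"
proof -
  define N where "N = sqrt (A + C)"
  have N: "0 < N" "N\<^sup>2 = A + C" using assms by (auto simp: N_def)
  have le: "sqrt C \<le> N" using assms by (simp add: N_def)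
  have "N\<^sup>2 \<le> (N + b)\<^sup>2"
    using assms N by (intro power_mono) auto
  hence "A / (N + b)\<^sup>2 + C / N\<^sup>2 \<le> A / N\<^sup>2 + C / N\<^sup>2"
    using assms N(1) by (intro add_right_mono divide_left_mono) auto
  also have "\<dots> = 1"
    using N assms by (simp flip: add_divide_distrib)
  finally have "speed_sq A C b N \<le> 1"
    by (simp add: speed_sq_def)
  moreover have "1 \<le> speed_sq A C b (sqrt C)"
    using assms by (simp add: speed_sq_def)
  moreover have "continuous_on {sqrt C..N} (speed_sq A C b)"
  proof -
    have "0 < y \<and> 0 < y + b" if "y \<in> {sqrt C..N}" for y
      using that assms real_sqrt_gt_zero[OF \<open>0 < C\<close>] unfolding atLeastAtMost_iff by linarith
    thus ?thesis
      unfolding speed_sq_def by (intro continuous_intros) fastforce+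
  qed
  ultimately obtain x where "sqrt C \<le> x" "speed_sq A C b x = 1"
    using IVT2'[of "speed_sq A C b" N 1 "sqrt C"] le by auto
  moreover from this have "0 < x"
    using assms real_sqrt_gt_zero[of C] by linarith
  ultimately show ?thesis
    using speed_sq_less[OF assms] by (metis less_irrefl linorder_less_linear)
qed

lemma Omega2_imp:
  assumes "0 < cD U" "\<xi> \<in> Omega2 U" "0 \<le> A" "0 \<le> C"
    and AC: "A + C = (norm (cm U))\<^sup>2" "C * (norm (cB U))\<^sup>2 = (tau U)\<^sup>2"
  shows "0 < \<xi>" and "(cD U / \<xi>)\<^sup>2 < 1 - speed_sq A C ((norm (cB U))\<^sup>2) \<xi>"
proof -
  define b where "b = (norm (cB U))\<^sup>2"
  \<comment> \<open>Subtracting \<open>D\<^sup>2 * (y + b)\<^sup>2\<close> from \<open>f_a\<close>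
    amounts to adding \<open>D\<^sup>2 / y\<^sup>2\<close> to the squared speed.\<close>
  define g where "g = speed_sq A (C + (cD U)\<^sup>2) b"
  have b: "0 \<le> b" by (simp add: b_def)
  have g: "g y = speed_sq A C b y + (cD U / y)\<^sup>2" for y
    by (simp add: g_def speed_sq_def add_divide_distrib power_divide)
  have C: "0 < C + (cD U)\<^sup>2" using assms by (simp add: add_nonneg_pos)
  have f_b: "f_b U y = (y * (y + b))\<^sup>2 * (1 - g y)" if "0 < y" for y
  proof -
    have "(y * (y + b))\<^sup>2 * (cD U / y)\<^sup>2 = (cD U)\<^sup>2 * (y + b)\<^sup>2"
      using that by (simp add: field_simps power2_eq_square)
    thus ?thesis
      unfolding f_b_def f_a_eq_speed_sq[OF AC that] g b_def by (simp add: algebra_simps)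
  qed
  \<comment> \<open>At a positive zero of \<open>f_b\<close>, \<open>f_a\<close> equals
    \<open>D\<^sup>2 * (y + b)\<^sup>2 > 0\<close>, so such a zero lies in \<open>Omega1 U\<close>.
    Thus \<open>xi_b U\<close> is the unique positive solution of \<open>g y = 1\<close>.\<close>
  have iff: "y \<in> Omega1 U \<and> f_b U y = 0 \<longleftrightarrow> 0 < y \<and> g y = 1" for y
  proof (cases "0 < y")
    case True
    hence "0 < y + b" using b by linarith
    moreover have "f_a U y = f_b U y + (cD U)\<^sup>2 * (y + b)\<^sup>2"
      by (simp add: f_b_def b_def)
    ultimately show ?thesis
      using True \<open>0 < cD U\<close> by (auto simp: Omega1_def f_b)
  qed (auto simp: Omega1_def)
  have ex1: "\<exists>!y. 0 < y \<and> g y = 1"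
    unfolding g_def using speed_sq_eq_1_ex1[OF \<open>0 \<le> A\<close> C b] .
  have xi_b: "0 < xi_b U" "g (xi_b U) = 1"
    using theI'[OF ex1] unfolding xi_b_def iff by auto
  have "xi_b U < \<xi>" using assms by (simp add: Omega2_def)
  thus "0 < \<xi>" using xi_b by linarith
  have "g \<xi> < 1"
    using speed_sq_less[OF \<open>0 \<le> A\<close> C b xi_b(1) \<open>xi_b U < \<xi>\<close>] xi_b(2) by (simp add: g_def)
  thus "(cD U / \<xi>)\<^sup>2 < 1 - speed_sq A C ((norm (cB U))\<^sup>2) \<xi>"
    by (simp add: g b_def)
qed

section \<open>Closed form of \<open>F\<close> and its derivatives\<close>

lemma F_eq_speed_sq:
  fixes \<gamma> :: real
  assumes AC: "A + C = (norm (cm U))\<^sup>2" "C * (norm (cB U))\<^sup>2 = (tau U)\<^sup>2"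
    and y: "0 < y" "speed_sq A C ((norm (cB U))\<^sup>2) y < 1"
  defines "b \<equiv> (norm (cB U))\<^sup>2" and "k \<equiv> (\<gamma> - 1) / \<gamma>"
  shows "F \<gamma> U y = y - k * (y - y * speed_sq A C b y - cD U * sqrt (1 - speed_sq A C b y))
    + b / 2 * (A / (y + b)\<^sup>2) + b / 2 - cE U"
proof -
  define w where "w = 1 - speed_sq A C b y"
  have b: "0 < y + b" using y by (simp add: b_def add_pos_nonneg)
  have w: "0 < w" using y by (simp add: w_def b_def)
  have "W U y = y * (y + b) / sqrt ((y * (y + b))\<^sup>2 * w)"
    using f_a_eq_speed_sq[OF AC y(1)] by (simp add: W_def b_def w_def)
  also have "\<dots> = 1 / sqrt w"
    using y b w by (simp add: real_sqrt_mult)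
  finally have W: "W U y = 1 / sqrt w" .
  \<comment> \<open>The \<open>C\<close> part of \<open>b * w\<close> cancels against
    \<open>\<tau>\<^sup>2 / y\<^sup>2\<close>, because
    \<open>\<tau>\<^sup>2 = C * b\<close>.\<close>
  have "b * w + (tau U)\<^sup>2 / y\<^sup>2 = b - b * (A / (y + b)\<^sup>2)"
    unfolding AC(2)[symmetric] by (simp add: w_def speed_sq_def b_def algebra_simps)
  hence "b / (W U y)\<^sup>2 + (tau U)\<^sup>2 / y\<^sup>2 = b - b * (A / (y + b)\<^sup>2)"
    using w by (simp add: W power_divide)
  thus ?thesis
    using w unfolding F_def k_def b_def[symmetric] w_def[symmetric]
    by (simp add: W power_divide w_def algebra_simps)
qed

lemma F_derivs:
  fixes \<gamma> :: real
  assumes AC: "A + C = (norm (cm U))\<^sup>2" "C * (norm (cB U))\<^sup>2 = (tau U)\<^sup>2"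
    and \<xi>: "0 < \<xi>" "speed_sq A C ((norm (cB U))\<^sup>2) \<xi> < 1"
  defines "b \<equiv> (norm (cB U))\<^sup>2" and "k \<equiv> (\<gamma> - 1) / \<gamma>"
  defines "s \<equiv> sqrt (1 - speed_sq A C b \<xi>)"
  defines "u1 \<equiv> - 2 * A / (\<xi> + b) ^ 3 - 2 * C / \<xi> ^ 3"
    and "u2 \<equiv> 6 * A / (\<xi> + b) ^ 4 + 6 * C / \<xi> ^ 4"
    and "u3 \<equiv> - 24 * A / (\<xi> + b) ^ 5 - 24 * C / \<xi> ^ 5"
  shows "(deriv ^^ 2) (F \<gamma> U) \<xi> = k * (2 * u1 + \<xi> * u2 + cD U * (- u2 / (2 * s) - u1\<^sup>2 / (4 * s ^ 3)))
      + 3 * b * A / (\<xi> + b) ^ 4"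
    and "(deriv ^^ 3) (F \<gamma> U) \<xi> = k * (3 * u2 + \<xi> * u3
        + cD U * (- u3 / (2 * s) - 3 * u1 * u2 / (4 * s ^ 3) - 3 * u1 ^ 3 / (8 * s ^ 5)))
      - 12 * b * A / (\<xi> + b) ^ 5"
proof -
  define v where "v = speed_sq A C b"
  \<comment> \<open>All of the shape \<open>\<alpha> / (y + b) ^ n + \<beta> / y ^ n\<close>, so one
    rule differentiates each into the next.\<close>
  define v1 where "v1 = (\<lambda>y. - 2 * A / (y + b) ^ 3 + - 2 * C / y ^ 3)"
  define v2 where "v2 = (\<lambda>y. 6 * A / (y + b) ^ 4 + 6 * C / y ^ 4)"
  define v3 where "v3 = (\<lambda>y. - 24 * A / (y + b) ^ 5 + - 24 * C / y ^ 5)"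
  define r where "r = (\<lambda>y. sqrt (1 - v y))"
  \<comment> \<open>On this set the closed form of \<open>F\<close> holds and the radicand
    \<open>1 - v y\<close> is positive.\<close>
  define S where "S = {0<..} \<inter> v -` {..<1}"
  have b: "0 \<le> b" by (simp add: b_def)
  have dinv: "((\<lambda>y. c / (y + e) ^ n) has_real_derivative - (real n * c) / (y + e) ^ Suc n) (at y)"
    if "0 < y + e" for c e y and n :: nat
  proof -
    have "((\<lambda>z. c / z ^ n) has_real_derivative - (real n * c) / z ^ Suc n) (at z)" if "0 < z" for z
      using that
      by (cases n)
        (auto intro!: DERIV_cong[OF DERIV_divide[OF DERIV_const DERIV_pow]]
          simp: field_simps simp del: power_Suc, simp add: field_simps)
    from this[OF that] show ?thesis
      by (simp add: DERIV_shift)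
  qed
  have d: "((\<lambda>y. \<alpha> / (y + b) ^ n + \<beta> / y ^ n) has_real_derivative
      - (real n * \<alpha>) / (y + b) ^ Suc n + - (real n * \<beta>) / y ^ Suc n) (at y)"
    if "0 < y" for \<alpha> \<beta> y and n :: nat
    using DERIV_add[OF dinv[of y b] dinv[of y 0]] that b by (simp del: power_Suc)
  have dv: "(v has_real_derivative v1 y) (at y)" "(v1 has_real_derivative v2 y) (at y)"
    "(v2 has_real_derivative v3 y) (at y)" if "0 < y" for y
    unfolding v_def speed_sq_def[abs_def] v1_def v2_def v3_def
    using d[of y A 2 C] d[of y "- 2 * A" 3 "- 2 * C"] d[of y "6 * A" 4 "6 * C"] that
    by (simp_all del: power_Suc)
  have "continuous_on {0<..} v"
    using dv by (intro DERIV_continuous_on) (auto intro: has_field_derivative_at_within)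
  hence S: "open S"
    unfolding S_def by (rule continuous_open_preimage) auto
  have "\<xi> \<in> S" using \<xi> by (simp add: S_def v_def b_def)
  define g0 where "g0 = (\<lambda>y. y - k * (y - y * v y - cD U * r y) + b / 2 * (A / (y + b)\<^sup>2) + b / 2 - cE U)"
  define g1 where "g1 = (\<lambda>y. 1 - k * (1 - v y - y * v1 y - cD U * (- v1 y / (2 * r y))) - b * A / (y + b) ^ 3)"
  define g2 where "g2 = (\<lambda>y. k * (2 * v1 y + y * v2 y + cD U * (- v2 y / (2 * r y) - (v1 y)\<^sup>2 / (4 * r y ^ 3)))
      + 3 * b * A / (y + b) ^ 4)"
  define g3 where "g3 = (\<lambda>y. k * (3 * v2 y + y * v3 y
        + cD U * (- v3 y / (2 * r y) - 3 * v1 y * v2 y / (4 * r y ^ 3) - 3 * v1 y ^ 3 / (8 * r y ^ 5)))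
      - 12 * b * A / (y + b) ^ 5)"
  have iterated: "(deriv ^^ 2) (F \<gamma> U) \<xi> = g2 \<xi> \<and> (deriv ^^ 3) (F \<gamma> U) \<xi> = g3 \<xi>"
  proof (rule iterated_deriv_eq[OF S \<open>\<xi> \<in> S\<close>])
    fix y assume "y \<in> S"
    hence y: "0 < y" "v y < 1" "0 < y + b" using b by (auto simp: S_def)
    note dr = sqrt_one_minus_derivs[of v v1 y v2 v3, OF dv[OF y(1)] y(2)]
    have r_eq: "sqrt (1 - v y) = r y" for y by (simp add: r_def)
    note d = dv[OF y(1)] dr[unfolded r_eq] dinv[OF y(3)]
    show "F \<gamma> U y = g0 y"
      using F_eq_speed_sq[OF AC, of y \<gamma>] y by (simp add: g0_def r_def v_def b_def k_def)
    show "(g0 has_real_derivative g1 y) (at y)" unfolding g0_def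
      by (rule derivative_eq_intros d refl)+ (simp add: g1_def field_simps numeral_3_eq_3 numeral_2_eq_2)
    show "(g1 has_real_derivative g2 y) (at y)" unfolding g1_def
      by (rule derivative_eq_intros d refl)+ (simp add: g2_def algebra_simps eval_nat_numeral)
    show "(g2 has_real_derivative g3 y) (at y)" unfolding g2_def
      by (rule derivative_eq_intros d refl)+ (simp add: g3_def algebra_simps eval_nat_numeral)
  qed
  have at_\<xi>: "v1 \<xi> = u1" "v2 \<xi> = u2" "v3 \<xi> = u3" "r \<xi> = s"
    by (simp_all add: v1_def u1_def v2_def u2_def v3_def u3_def r_def s_def v_def)
  show "(deriv ^^ 2) (F \<gamma> U) \<xi> = k * (2 * u1 + \<xi> * u2 + cD U * (- u2 / (2 * s) - u1\<^sup>2 / (4 * s ^ 3)))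
      + 3 * b * A / (\<xi> + b) ^ 4"
    and "(deriv ^^ 3) (F \<gamma> U) \<xi> = k * (3 * u2 + \<xi> * u3
        + cD U * (- u3 / (2 * s) - 3 * u1 * u2 / (4 * s ^ 3) - 3 * u1 ^ 3 / (8 * s ^ 5)))
      - 12 * b * A / (\<xi> + b) ^ 5"
    using iterated by (simp_all add: g2_def g3_def at_\<xi>)
qed

section \<open>Substitution of the scaled variables\<close>

theorem theorem3p12:
  fixes \<gamma> \<xi> :: real and U :: conservative
  assumes "\<gamma> \<in> {1<..2}"
    and "U \<in> admissible"
    and "cm U \<noteq> 0"
    and "\<xi> \<in> Omega2 U"
  shows "\<xi> * (deriv ^^ 3) (F \<gamma> U) \<xi> + 4 * (deriv ^^ 2) (F \<gamma> U) \<xi> > 0"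
proof -
  obtain A C where AC: "0 \<le> A" "0 \<le> C"
    "A + C = (norm (cm U))\<^sup>2" "C * (norm (cB U))\<^sup>2 = (tau U)\<^sup>2"
    by (rule partial_fraction_coefficients)
  have D: "0 < cD U" using assms by (simp add: admissible_def)
  define b where "b = (norm (cB U))\<^sup>2"
  define k where "k = (\<gamma> - 1) / \<gamma>"
  define x where "x = \<xi> + b"
  define w where "w = 1 - speed_sq A C b \<xi>"
  define s where "s = sqrt w"
  define a where "a = A / x\<^sup>2"
  define c where "c = C / \<xi>\<^sup>2"
  define t where "t = \<xi> / x"
  \<comment> \<open>The range \<open>0 < D < \<xi> * s\<close> becomes
    \<open>0 < e < 1\<close>.\<close>
  define e where "e = cD U / (\<xi> * s)"
  define P where "P = c + a * t"
  define Q where "Q = c + a * t\<^sup>2"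
  have \<xi>: "0 < \<xi>" and Dw: "(cD U / \<xi>)\<^sup>2 < w"
    using Omega2_imp[OF D assms(4) AC] by (auto simp: w_def b_def)
  have b: "0 \<le> b" by (simp add: b_def)
  have x: "0 < x" "\<xi> \<le> x" using \<xi> b by (auto simp: x_def)
  have w: "0 < w" using Dw zero_le_power2[of "cD U / \<xi>"] by linarith
  have s: "0 < s" "s\<^sup>2 = w" using w by (auto simp: s_def)
  have "cD U / \<xi> < s" using Dw by (simp add: s_def real_less_rsqrt)
  hence e: "0 < e" "e < 1" using D \<xi> s by (auto simp: e_def field_simps)
  have k: "0 < k" "k \<le> 1/2" using assms(1) by (auto simp: k_def field_simps)
  have t: "0 < t" "t \<le> 1" using \<xi> x by (auto simp: t_def)
  \<comment> \<open>Nonzero momentum excludes \<open>a = c = 0\<close>, where the expression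
    vanishes.\<close>
  have "0 < A + C" using AC assms(3) by simp
  hence "0 < a + c"
    using AC \<xi> x by (auto simp: a_def c_def less_le add_nonneg_eq_0_iff)
  have "0 \<le> a" "0 \<le> c" using AC by (auto simp: a_def c_def)
  note main = scaled_inequality[OF this \<open>0 < a + c\<close> t w e k, folded P_def Q_def]
  have A: "A = a * x\<^sup>2" and C: "C = c * \<xi>\<^sup>2" and t_eq: "\<xi> = t * x" and b_eq: "b = (1 - t) * x"
    using \<xi> x by (auto simp: a_def c_def t_def x_def field_simps)
  have u1: "- 2 * A / x ^ 3 - 2 * C / \<xi> ^ 3 = - 2 * P / \<xi>"
    using x t unfolding A C P_def t_eq by (simp add: field_simps eval_nat_numeral)
  have u2: "6 * A / x ^ 4 + 6 * C / \<xi> ^ 4 = 6 * Q / \<xi>\<^sup>2"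
    using x t unfolding A C Q_def t_eq by (simp add: field_simps eval_nat_numeral)
  have u3: "- 24 * A / x ^ 5 - 24 * C / \<xi> ^ 5 = - 24 * (c + a * t ^ 3) / \<xi> ^ 3"
    using x t unfolding A C t_eq by (simp add: field_simps eval_nat_numeral)
  have b4: "3 * b * A / x ^ 4 = 3 * (1 - t) * a * t / \<xi>"
    using x t unfolding A b_eq t_eq by (simp add: field_simps eval_nat_numeral)
  have b5: "12 * b * A / x ^ 5 = 12 * (1 - t) * a * t\<^sup>2 / \<xi>\<^sup>2"
    using x t unfolding A b_eq t_eq by (simp add: field_simps eval_nat_numeral)
  have De: "cD U = e * (\<xi> * s)" using \<xi> s by (simp add: e_def)
  have "speed_sq A C ((norm (cB U))\<^sup>2) \<xi> < 1" using w by (simp add: w_def b_def)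
  note derivs = F_derivs[OF AC(3,4) \<xi> this, where \<gamma> = \<gamma>, folded b_def, folded k_def w_def x_def,
      folded s_def, unfolded u1 u2 u3 b4 b5 De]
  \<comment> \<open>The extra factor \<xi> cancels all powers of \<xi>. The two terms with
    \<open>b\<close> combine to \<open>12 * (1 - t) * a * t * (1 - t)\<close>.\<close>
  have "\<xi> * (\<xi> * (deriv ^^ 3) (F \<gamma> U) \<xi> + 4 * (deriv ^^ 2) (F \<gamma> U) \<xi>)
      = k * (- 16 * P + 42 * Q - 24 * (c + a * t ^ 3)) + 12 * (1 - t)\<^sup>2 * a * t
        + k * e * (12 * (c + a * t ^ 3) - 12 * Q + (9 * P * Q - 4 * P\<^sup>2) / s\<^sup>2 + 3 * P ^ 3 / (s\<^sup>2)\<^sup>2)"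
    unfolding derivs using \<xi> s(1) by (simp add: field_simps eval_nat_numeral)
  also have "\<dots> > 0" using main by (simp add: s)
  finally show ?thesis
    using \<xi> zero_less_mult_pos by blast
qed

end
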